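(* Let $\lambda>0$ and $s,t\in(0,1]$, and let $\boldsymbol{P}^{s}_{t,\lambda}=m_t+\sqrt{\lambda}\,(a_s^{\dagger}+a_s)+\lambda k_s$ on the one-mode $s$-free Fock space. Then for every integer $n\ge1$, the $n$-th moment of the $s$-free Poisson distribution $\Pi^{s}_{t,\lambda}$ of parameters $\lambda$ and $t$ (the distribution of $\boldsymbol{P}^{s}_{t,\lambda}$ with respect to the vacuum expectation $\varphi$) is given by $$\varphi\Bigl(\bigl(\boldsymbol{P}^{s}_{t,\lambda}\bigr)^n\Bigr)=\sum_{\pi\in\mathcal{NC}(n)}\lambda^{|\pi|}\,s^{\mathrm{td}_1(\pi)}\,t^{\mathrm{td}_2(\pi)}.$$
   Context: One-mode $s$-free Fock space: let $\xi$ be a unit vector and let $\Omega=\xi^{\otimes 0}$ be the vacuum vector. For $0<s\le 1$, $\mathcal{F}_s$ is the Hilbert space completion of the linear span of the vectors $\xi^{\otimes n}$, $n\ge0$, with respect to the inner product determined by $(\xi^{\otimes n}\,|\,\xi^{\otimes m})_s=\delta_{m,n}\,s^{n(n-1)/2}$. Operators on $\mathcal{F}_s$ (for $s,t\in(0,1]$): the $s$-creation operator $a_s^{\dagger}\xi^{\otimes m}=\xi^{\otimes(m+1)}$ for $m\ge0$; the $s$-annihilation operator $a_s$, which is the adjoint of $a_s^\dagger$ with respect to $(\cdot|\cdot)_s$ and acts by $a_s\Omega=0$, $a_s\xi^{\otimes m}=s^{m-1}\xi^{\otimes(m-1)}$ for $m\ge1$; the scalar operator $k_s\xi^{\otimes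 m}=s^m\xi^{\otimes m}$ for $m\ge0$; the intermediate operator $m_t\Omega=0$, $m_t\xi^{\otimes m}=t^{m-1}\xi^{\otimes m}$ for $m\ge1$. The vacuum expectation of a bounded operator $b$ on $\mathcal{F}_s$ is $\varphi(b)=(b\,\Omega\,|\,\Omega)_s$. Partitions: $\mathcal{NC}(n)$ is the set of non-crossing partitions of $[n]=\{1,\dots,n\}$, i.e. set partitions with no two distinct blocks $B_i\ne B_j$ and elements $b_1,b_2\in B_i$, $c_1,c_2\in B_j$ such that $b_1<c_1<b_2<c_2$. $|\pi|$ is the number of blocks of $\pi$ and $|B|$ the size of a block $B$. For a block $C$, $f_C$ and $\ell_C$ denote its minimum and maximum elements (equal for a singleton); an intermediate element $i_C$ of a block with $|C|\ge3$ is any element of $C$ other than $f_C,\ell_C$. A block $C$ covers $a\in[n]$ if $a\notin C$ and $f_C\le a\le\ell_C$. For $a\in[n]$, $\mathrm{dp}(a)=\#\{C\in\pi: C\text{ covers }a\}$; in a non-crossing partition, all elements of one block have the same value of $\mathrm{dp}$, so $\mathrm{dp}(i_B)$ does not depend on the choice of the intermediate element. Define $$\mathrm{td}_1(\pi)=\sum_{B\in\pi}\mathrm{dp}(\ell_B),\qquad \mathrm{td}_2(\pi)=\sum_{B\in\pi,\ |B|\ge3}(|B|-2)\,\mathrm{dp}(i_B).$$ *)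

theory Defs
  imports "HOL-Library.Disjoint_Sets" "HOL-Probability.Probability"
begin

section \<open>The one-mode s-free Fock space\<close>

text \<open>
  The Hilbert space completion of the span of the orthogonal vectors \<open>\<xi>\<^sup>\<otimes>\<^sup>n\<close> is realised as the
  weighted sequence space of all \<open>x :: nat \<Rightarrow> complex\<close> of finite norm, where \<open>x n\<close> is the
  coefficient of \<open>\<xi>\<^sup>\<otimes>\<^sup>n\<close>. The inner product is linear in its first argument.
\<close>

type_synonym fvec = "nat \<Rightarrow> complex"

definition fock_weight :: "real \<Rightarrow> nat \<Rightarrow> real" where
  "fock_weight s n = s ^ (n * (n - 1) div 2)"

definition fock_space :: "real \<Rightarrow> fvec set" where
  "fock_space s = {x. summable (\<lambda>n. fock_weight s n * (cmod (x n))\<^sup>2)}"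

definition fock_inner :: "real \<Rightarrow> fvec \<Rightarrow> fvec \<Rightarrow> complex" where
  "fock_inner s x y = (\<Sum>n. of_real (fock_weight s n) * (x n * cnj (y n)))"

definition fock_norm :: "real \<Rightarrow> fvec \<Rightarrow> real" where
  "fock_norm s x = sqrt (Re (fock_inner s x x))"

definition xi :: "nat \<Rightarrow> fvec" where
  "xi m = (\<lambda>n. if n = m then 1 else 0)"

definition vacuum :: fvec where
  "vacuum = xi 0"

text \<open>
  The operators are the bounded linear operators determined by their action on the vectors
  \<open>xi m\<close>, written in coordinates; the action itself is recovered in \<open>creation_xi\<close>,
  \<open>annihilation_xi\<close>, \<open>scalar_op_xi\<close> and \<open>intermediate_xi\<close> below.
\<close>

definition creation :: "fvec \<Rightarrow> fvec" where
  "creation x = (\<lambda>n. if n = 0 then 0 else x (n - 1))"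

definition annihilation :: "real \<Rightarrow> fvec \<Rightarrow> fvec" where
  "annihilation s x = (\<lambda>n. of_real (s ^ n) * x (n + 1))"

definition scalar_op :: "real \<Rightarrow> fvec \<Rightarrow> fvec" where
  "scalar_op s x = (\<lambda>n. of_real (s ^ n) * x n)"

definition intermediate :: "real \<Rightarrow> fvec \<Rightarrow> fvec" where
  "intermediate t x = (\<lambda>n. if n = 0 then 0 else of_real (t ^ (n - 1)) * x n)"

definition vacuum_expectation :: "real \<Rightarrow> (fvec \<Rightarrow> fvec) \<Rightarrow> complex" where
  "vacuum_expectation s b = fock_inner s (b vacuum) vacuum"

definition poisson_op :: "real \<Rightarrow> real \<Rightarrow> real \<Rightarrow> fvec \<Rightarrow> fvec" where
  "poisson_op s t lam x = (\<lambda>n. intermediate t x n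
     + of_real (sqrt lam) * (creation x n + annihilation s x n)
     + of_real lam * scalar_op s x n)"

text \<open>
  The distribution of a bounded self-adjoint operator \<open>b\<close> with respect to the vacuum expectation:
  the (unique) compactly supported probability measure on the real line whose moments are those
  of \<open>b\<close>.
\<close>

definition is_vacuum_distribution :: "real \<Rightarrow> (fvec \<Rightarrow> fvec) \<Rightarrow> real measure \<Rightarrow> bool" where
  "is_vacuum_distribution s b \<mu> \<longleftrightarrow>
     prob_space \<mu> \<and> sets \<mu> = sets borel \<and> (\<exists>K. compact K \<and> (AE x in \<mu>. x \<in> K)) \<and>
     (\<forall>k. vacuum_expectation s (b ^^ k) = of_real (\<integral>x. x ^ k \<partial>\<mu>))"


section \<open>Non-crossing partitions\<close>

definition noncrossing :: "nat set set \<Rightarrow> bool" where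
  "noncrossing \<pi> \<longleftrightarrow>
     \<not> (\<exists>B\<in>\<pi>. \<exists>C\<in>\<pi>. B \<noteq> C \<and> (\<exists>b1\<in>B. \<exists>b2\<in>B. \<exists>c1\<in>C. \<exists>c2\<in>C. b1 < c1 \<and> c1 < b2 \<and> b2 < c2))"

definition NC :: "nat \<Rightarrow> nat set set set" where
  "NC n = {\<pi>. partition_on {1..n} \<pi> \<and> noncrossing \<pi>}"

definition covers :: "nat set \<Rightarrow> nat \<Rightarrow> bool" where
  "covers C a \<longleftrightarrow> a \<notin> C \<and> Min C \<le> a \<and> a \<le> Max C"

definition dp :: "nat set set \<Rightarrow> nat \<Rightarrow> nat" where
  "dp \<pi> a = card {C \<in> \<pi>. covers C a}"

definition intermediate_elem :: "nat set \<Rightarrow> nat" where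
  "intermediate_elem B = (SOME i. i \<in> B \<and> i \<noteq> Min B \<and> i \<noteq> Max B)"

definition td1 :: "nat set set \<Rightarrow> nat" where
  "td1 \<pi> = (\<Sum>B\<in>\<pi>. dp \<pi> (Max B))"

definition td2 :: "nat set set \<Rightarrow> nat" where
  "td2 \<pi> = (\<Sum>B\<in>{B \<in> \<pi>. card B \<ge> 3}. (card B - 2) * dp \<pi> (intermediate_elem B))"


section \<open>Consistency of the definitions\<close>

subsection \<open>The sequence space is the Hilbert space completion\<close>

lemma fock_weight_pos: "0 < s \<Longrightarrow> fock_weight s n > 0"
  by (simp add: fock_weight_def)

lemma fock_weight_Suc: "fock_weight s (Suc n) = s ^ n * fock_weight s n"
proof -
  have "Suc n * (Suc n - 1) div 2 = n + n * (n - 1) div 2"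
    by (cases n) (auto simp: algebra_simps)
  then show ?thesis by (simp only: fock_weight_def power_add)
qed

lemma fock_inner_summable:
  assumes s: "0 < s" and x: "x \<in> fock_space s" and y: "y \<in> fock_space s"
  shows "summable (\<lambda>n. of_real (fock_weight s n) * (x n * cnj (y n)))"
proof (rule summable_comparison_test')
  show "summable (\<lambda>n. fock_weight s n * (cmod (x n))\<^sup>2 + fock_weight s n * (cmod (y n))\<^sup>2)"
    using x y by (auto simp: fock_space_def intro: summable_add)
  fix n
  have w: "fock_weight s n > 0" by (rule fock_weight_pos[OF s])
  have "2 * (cmod (x n) * cmod (y n)) \<le> (cmod (x n))\<^sup>2 + (cmod (y n))\<^sup>2"
    using sum_squares_bound[of "cmod (x n)" "cmod (y n)"] by simp
  moreover have "0 \<le> cmod (x n) * cmod (y n)" by simp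
  ultimately have "cmod (x n) * cmod (y n) \<le> (cmod (x n))\<^sup>2 + (cmod (y n))\<^sup>2"
    by linarith
  then have "fock_weight s n * (cmod (x n) * cmod (y n))
      \<le> fock_weight s n * ((cmod (x n))\<^sup>2 + (cmod (y n))\<^sup>2)"
    using w by (intro mult_left_mono) auto
  then show "norm (of_real (fock_weight s n) * (x n * cnj (y n)))
      \<le> fock_weight s n * (cmod (x n))\<^sup>2 + fock_weight s n * (cmod (y n))\<^sup>2"
    using w by (simp add: norm_mult distrib_left)
qed

lemma fock_space_add:
  assumes s: "0 < s" and x: "x \<in> fock_space s" and y: "y \<in> fock_space s"
  shows "(\<lambda>n. x n + y n) \<in> fock_space s"
proof -
  have "summable (\<lambda>n. fock_weight s n * (cmod (x n + y n))\<^sup>2)"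
  proof (rule summable_comparison_test')
    show "summable (\<lambda>n. 2 * (fock_weight s n * (cmod (x n))\<^sup>2) + 2 * (fock_weight s n * (cmod (y n))\<^sup>2))"
      using x y by (auto simp: fock_space_def intro: summable_add summable_mult)
    fix n
    have w: "fock_weight s n > 0" by (rule fock_weight_pos[OF s])
    have "(cmod (x n + y n))\<^sup>2 \<le> (cmod (x n) + cmod (y n))\<^sup>2"
      by (intro power_mono norm_triangle_ineq) auto
    also have "\<dots> \<le> 2 * (cmod (x n))\<^sup>2 + 2 * (cmod (y n))\<^sup>2"
      using sum_squares_bound[of "cmod (x n)" "cmod (y n)"] by (simp add: power2_sum)
    finally have "fock_weight s n * (cmod (x n + y n))\<^sup>2
        \<le> fock_weight s n * (2 * (cmod (x n))\<^sup>2 + 2 * (cmod (y n))\<^sup>2)"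
      using w by (intro mult_left_mono) auto
    then show "norm (fock_weight s n * (cmod (x n + y n))\<^sup>2)
        \<le> 2 * (fock_weight s n * (cmod (x n))\<^sup>2) + 2 * (fock_weight s n * (cmod (y n))\<^sup>2)"
      using w by (simp add: algebra_simps)
  qed
  then show ?thesis by (simp add: fock_space_def)
qed

lemma fock_space_scale: "x \<in> fock_space s \<Longrightarrow> (\<lambda>n. c * x n) \<in> fock_space s"
proof -
  assume "x \<in> fock_space s"
  then have "summable (\<lambda>n. (cmod c)\<^sup>2 * (fock_weight s n * (cmod (x n))\<^sup>2))"
    by (auto simp: fock_space_def intro: summable_mult)
  then show ?thesis
    by (simp add: fock_space_def norm_mult power_mult_distrib mult.left_commute)
qed

lemma fock_space_diff:
  assumes s: "0 < s" and x: "x \<in> fock_space s" and y: "y \<in> fock_space s"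
  shows "(\<lambda>n. x n - y n) \<in> fock_space s"
  using fock_space_add[OF s x fock_space_scale[OF y, of "-1"]] by simp

lemma fock_norm_eq:
  assumes s: "0 < s" and x: "x \<in> fock_space s"
  shows "fock_norm s x = sqrt (\<Sum>n. fock_weight s n * (cmod (x n))\<^sup>2)"
proof -
  have "(\<lambda>n. fock_weight s n * (cmod (x n))\<^sup>2) sums (\<Sum>n. fock_weight s n * (cmod (x n))\<^sup>2)"
    using x by (simp add: fock_space_def summable_sums)
  then have "(\<lambda>n. complex_of_real (fock_weight s n * (cmod (x n))\<^sup>2)) sums
      of_real (\<Sum>n. fock_weight s n * (cmod (x n))\<^sup>2)"
    by (rule sums_of_real)
  moreover have "(\<lambda>n. complex_of_real (fock_weight s n * (cmod (x n))\<^sup>2)) =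
      (\<lambda>n. of_real (fock_weight s n) * (x n * cnj (x n)))"
    by (simp only: complex_norm_square of_real_mult)
  ultimately have "fock_inner s x x = of_real (\<Sum>n. fock_weight s n * (cmod (x n))\<^sup>2)"
    by (simp add: fock_inner_def sums_iff)
  then show ?thesis by (simp add: fock_norm_def)
qed

lemma fock_norm_nonneg:
  assumes s: "0 < s" and x: "x \<in> fock_space s"
  shows "0 \<le> fock_norm s x"
proof -
  have "summable (\<lambda>n. fock_weight s n * (cmod (x n))\<^sup>2)" using x by (simp add: fock_space_def)
  then show ?thesis
    unfolding fock_norm_eq[OF s x] using less_imp_le[OF fock_weight_pos[OF s]]
    by (simp add: suminf_nonneg)
qed

lemma xi_in_fock_space: "xi m \<in> fock_space s"
proof -
  have "summable (\<lambda>n. fock_weight s n * (cmod (xi m n))\<^sup>2)"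
    by (rule summable_finite[of "{m}"]) (auto simp: xi_def)
  then show ?thesis by (simp add: fock_space_def)
qed

lemma fock_inner_xi:
  "fock_inner s (xi n) (xi m) = (if m = n then of_real (s ^ (n * (n - 1) div 2)) else 0)"
proof -
  have "fock_inner s (xi n) (xi m)
      = (\<Sum>k\<in>{n}. of_real (fock_weight s k) * (xi n k * cnj (xi m k)))"
    unfolding fock_inner_def by (rule suminf_finite) (auto simp: xi_def)
  then show ?thesis by (auto simp: xi_def fock_weight_def)
qed

lemma fock_space_dense:
  assumes s: "0 < s" and x: "x \<in> fock_space s"
  shows "(\<lambda>N. fock_norm s (\<lambda>n. x n - (\<Sum>m<N. x m * xi m n))) \<longlonglongrightarrow> 0"
proof -
  define g where "g n = fock_weight s n * (cmod (x n))\<^sup>2" for n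
  have g: "summable g" using x by (simp add: fock_space_def g_def[abs_def])
  have tr: "(\<Sum>m<N. x m * xi m n) = (if n < N then x n else 0)" for n N
  proof -
    have "(\<Sum>m<N. x m * xi m n) = (\<Sum>m<N. if n = m then x m else 0)"
      by (rule sum.cong) (auto simp: xi_def)
    also have "\<dots> = (if n < N then x n else 0)" by (simp add: sum.delta')
    finally show ?thesis .
  qed
  have sp: "(\<lambda>n. if n < N then 0 else g n) sums (suminf g - sum g {..<N})" for N
  proof -
    have "(\<lambda>n. g n - (if n \<in> {..<N} then g n else 0)) sums (suminf g - sum g {..<N})"
      by (intro sums_diff summable_sums[OF g] sums_If_finite_set) auto
    moreover have "(\<lambda>n. g n - (if n \<in> {..<N} then g n else 0)) = (\<lambda>n. if n < N then 0 else g n)"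
      by auto
    ultimately show ?thesis by simp
  qed
  have eq: "fock_norm s (\<lambda>n. x n - (\<Sum>m<N. x m * xi m n)) = sqrt (suminf g - sum g {..<N})" for N
  proof -
    have *: "(\<lambda>n. fock_weight s n * (cmod (x n - (\<Sum>m<N. x m * xi m n)))\<^sup>2)
        = (\<lambda>n. if n < N then 0 else g n)"
      by (auto simp: tr g_def)
    then have "(\<lambda>n. x n - (\<Sum>m<N. x m * xi m n)) \<in> fock_space s"
      using sp[of N] by (simp add: fock_space_def sums_iff)
    from fock_norm_eq[OF s this] show ?thesis using * sp[of N] by (simp add: sums_iff)
  qed
  have "(\<lambda>N. sqrt (suminf g - sum g {..<N})) \<longlonglongrightarrow> sqrt (suminf g - suminf g)"
    by (intro tendsto_intros summable_LIMSEQ[OF g])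
  then show ?thesis by (simp add: eq)
qed

lemma fock_space_complete:
  assumes s: "0 < s" and X: "\<And>k. X k \<in> fock_space s"
    and Cauchy: "\<And>e. e > 0 \<Longrightarrow> \<exists>K. \<forall>k\<ge>K. \<forall>l\<ge>K. fock_norm s (\<lambda>n. X k n - X l n) < e"
  shows "\<exists>x\<in>fock_space s. (\<lambda>k. fock_norm s (\<lambda>n. X k n - x n)) \<longlonglongrightarrow> 0"
proof -
  have part: "(\<Sum>n<N. fock_weight s n * (cmod (X k n - X l n))\<^sup>2)
      \<le> (fock_norm s (\<lambda>n. X k n - X l n))\<^sup>2" for k l N
  proof -
    have d: "(\<lambda>n. X k n - X l n) \<in> fock_space s" using fock_space_diff[OF s X X] .
    then have sm: "summable (\<lambda>n. fock_weight s n * (cmod (X k n - X l n))\<^sup>2)"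
      by (simp add: fock_space_def)
    have nn: "0 \<le> fock_weight s n * (cmod (X k n - X l n))\<^sup>2" for n
      using fock_weight_pos[OF s, of n] by simp
    show ?thesis unfolding fock_norm_eq[OF s d]
      using sum_le_suminf[OF sm, of "{..<N}"] suminf_nonneg[OF sm] nn by simp
  qed
  have "\<exists>x. (\<lambda>k. X k n) \<longlonglongrightarrow> x" for n
  proof -
    have "Cauchy (\<lambda>k. X k n)"
    proof (rule metric_CauchyI)
      fix e :: real assume e: "e > 0"
      define w where "w = fock_weight s n"
      have w: "w > 0" unfolding w_def by (rule fock_weight_pos[OF s])
      obtain K where K: "\<And>k l. k \<ge> K \<Longrightarrow> l \<ge> K \<Longrightarrow> fock_norm s (\<lambda>n. X k n - X l n) < sqrt w * e"
        using Cauchy[of "sqrt w * e"] w e by auto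
      show "\<exists>M. \<forall>k\<ge>M. \<forall>l\<ge>M. dist (X k n) (X l n) < e"
      proof (intro exI allI impI)
        fix k l assume kl: "K \<le> k" "K \<le> l"
        define r where "r = fock_norm s (\<lambda>n. X k n - X l n)"
        have "w * (cmod (X k n - X l n))\<^sup>2 \<le> (\<Sum>n<Suc n. fock_weight s n * (cmod (X k n - X l n))\<^sup>2)"
          unfolding w_def using less_imp_le[OF fock_weight_pos[OF s]]
          by (intro member_le_sum[where f = "\<lambda>n. fock_weight s n * (cmod (X k n - X l n))\<^sup>2"]) auto
        also have "\<dots> \<le> r\<^sup>2" unfolding r_def by (rule part)
        finally have 1: "w * (cmod (X k n - X l n))\<^sup>2 \<le> r\<^sup>2" .
        have "r\<^sup>2 < (sqrt w * e)\<^sup>2"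
        proof (rule power_strict_mono)
          show "r < sqrt w * e" unfolding r_def by (rule K[OF kl])
          show "0 \<le> r" unfolding r_def by (rule fock_norm_nonneg[OF s fock_space_diff[OF s X X]])
        qed simp
        then have "w * (cmod (X k n - X l n))\<^sup>2 < w * e\<^sup>2"
          using le_less_trans[OF 1] w by (simp add: power_mult_distrib)
        then have "(cmod (X k n - X l n))\<^sup>2 < e\<^sup>2" using w by simp
        then have "cmod (X k n - X l n) < e" using e by (auto intro: power2_less_imp_less)
        then show "dist (X k n) (X l n) < e" by (simp add: dist_norm)
      qed
    qed
    then show ?thesis using Cauchy_convergent convergent_def by blast
  qed
  then obtain x where x: "\<And>n. (\<lambda>k. X k n) \<longlonglongrightarrow> x n" by metis
  have lim: "(\<lambda>n. X k n - x n) \<in> fock_space s \<and> fock_norm s (\<lambda>n. X k n - x n) \<le> e"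
    if e: "e > 0" and K: "\<forall>k\<ge>K. \<forall>l\<ge>K. fock_norm s (\<lambda>n. X k n - X l n) < e" and k: "k \<ge> K" for e K k
  proof -
    have nn: "0 \<le> fock_weight s n * (cmod (X k n - x n))\<^sup>2" for n
      using fock_weight_pos[OF s, of n] by simp
    have b: "(\<Sum>n<N. fock_weight s n * (cmod (X k n - x n))\<^sup>2) \<le> e\<^sup>2" for N
    proof (rule LIMSEQ_le_const2)
      show "(\<lambda>l. \<Sum>n<N. fock_weight s n * (cmod (X k n - X l n))\<^sup>2)
          \<longlonglongrightarrow> (\<Sum>n<N. fock_weight s n * (cmod (X k n - x n))\<^sup>2)"
        by (intro tendsto_intros x)
      show "\<exists>M. \<forall>l\<ge>M. (\<Sum>n<N. fock_weight s n * (cmod (X k n - X l n))\<^sup>2) \<le> e\<^sup>2"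
      proof (intro exI allI impI)
        fix l assume l: "K \<le> l"
        have "0 \<le> fock_norm s (\<lambda>n. X k n - X l n)"
          by (rule fock_norm_nonneg[OF s fock_space_diff[OF s X X]])
        then have "(fock_norm s (\<lambda>n. X k n - X l n))\<^sup>2 \<le> e\<^sup>2"
          using K k l by (intro power_mono) (auto intro: less_imp_le)
        then show "(\<Sum>n<N. fock_weight s n * (cmod (X k n - X l n))\<^sup>2) \<le> e\<^sup>2"
          using part[where k = k and l = l and N = N] by linarith
      qed
    qed
    have sm: "summable (\<lambda>n. fock_weight s n * (cmod (X k n - x n))\<^sup>2)"
      by (rule summableI_nonneg_bounded[OF nn b])
    then have mem: "(\<lambda>n. X k n - x n) \<in> fock_space s" by (simp add: fock_space_def)
    have "(\<Sum>n. fock_weight s n * (cmod (X k n - x n))\<^sup>2) \<le> e\<^sup>2"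
      by (rule suminf_le_const[OF sm b])
    then have "sqrt (\<Sum>n. fock_weight s n * (cmod (X k n - x n))\<^sup>2) \<le> e"
      using e by (intro real_le_lsqrt) auto
    then show ?thesis using mem fock_norm_eq[OF s mem] by simp
  qed
  obtain K1 where "\<forall>k\<ge>K1. \<forall>l\<ge>K1. fock_norm s (\<lambda>n. X k n - X l n) < 1" using Cauchy[of 1] by auto
  from lim[OF _ this order_refl] have "(\<lambda>n. X K1 n - x n) \<in> fock_space s" by simp
  from fock_space_diff[OF s X[of K1] this] have xF: "x \<in> fock_space s" by simp
  have "(\<lambda>k. fock_norm s (\<lambda>n. X k n - x n)) \<longlonglongrightarrow> 0"
  proof (rule LIMSEQ_I)
    fix r :: real assume r: "0 < r"
    obtain K where K: "\<forall>k\<ge>K. \<forall>l\<ge>K. fock_norm s (\<lambda>n. X k n - X l n) < r / 2"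
      using Cauchy[of "r / 2"] r by auto
    show "\<exists>no. \<forall>k\<ge>no. norm (fock_norm s (\<lambda>n. X k n - x n) - 0) < r"
    proof (intro exI allI impI)
      fix k assume k: "K \<le> k"
      have l: "(\<lambda>n. X k n - x n) \<in> fock_space s" "fock_norm s (\<lambda>n. X k n - x n) \<le> r / 2"
        using lim[OF _ K k] r by auto
      moreover have "0 \<le> fock_norm s (\<lambda>n. X k n - x n)"
        by (rule fock_norm_nonneg[OF s l(1)])
      ultimately show "norm (fock_norm s (\<lambda>n. X k n - x n) - 0) < r" using r by simp
    qed
  qed
  with xF show ?thesis by blast
qed


subsection \<open>The operators\<close>

lemma creation_xi: "creation (xi m) = xi (m + 1)"
  by (force simp: creation_def xi_def)

lemma annihilation_xi:
  "annihilation s vacuum = (\<lambda>_. 0)"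
  "m \<ge> 1 \<Longrightarrow> annihilation s (xi m) = (\<lambda>n. of_real (s ^ (m - 1)) * xi (m - 1) n)"
  by (auto simp: annihilation_def vacuum_def xi_def fun_eq_iff)

lemma scalar_op_xi: "scalar_op s (xi m) = (\<lambda>n. of_real (s ^ m) * xi m n)"
  by (auto simp: scalar_op_def xi_def)

lemma intermediate_xi:
  "intermediate t vacuum = (\<lambda>_. 0)"
  "m \<ge> 1 \<Longrightarrow> intermediate t (xi m) = (\<lambda>n. of_real (t ^ (m - 1)) * xi m n)"
  by (auto simp: intermediate_def vacuum_def xi_def fun_eq_iff)

lemma fock_norm_le:
  assumes s: "0 < s" and x: "x \<in> fock_space s"
    and le: "\<And>n. fock_weight s n * (cmod (y n))\<^sup>2 \<le> fock_weight s n * (cmod (x n))\<^sup>2"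
  shows "y \<in> fock_space s" "fock_norm s y \<le> fock_norm s x"
proof -
  have sx: "summable (\<lambda>n. fock_weight s n * (cmod (x n))\<^sup>2)" using x by (simp add: fock_space_def)
  have sy: "summable (\<lambda>n. fock_weight s n * (cmod (y n))\<^sup>2)"
    by (rule summable_comparison_test'[OF sx])
      (use le fock_weight_pos[OF s] in \<open>simp add: abs_mult less_imp_le\<close>)
  then show y: "y \<in> fock_space s" by (simp add: fock_space_def)
  show "fock_norm s y \<le> fock_norm s x"
    unfolding fock_norm_eq[OF s x] fock_norm_eq[OF s y]
    using suminf_le[OF le sy sx] by simp
qed

lemma creation_bounded:
  assumes s: "0 < s" "s \<le> 1" and x: "x \<in> fock_space s"
  shows "creation x \<in> fock_space s" "fock_norm s (creation x) \<le> fock_norm s x"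
proof -
  define f where "f n = fock_weight s n * (cmod (x n))\<^sup>2" for n
  define g where "g n = fock_weight s n * (cmod (creation x n))\<^sup>2" for n
  have f: "summable f" using x by (simp add: fock_space_def f_def[abs_def])
  have gS: "g (Suc n) = s ^ n * f n" for n
    by (simp add: g_def f_def creation_def fock_weight_Suc)
  have f0: "0 \<le> f n" for n using fock_weight_pos[of s n] s by (simp add: f_def)
  have le: "g (Suc n) \<le> f n" for n
    unfolding gS using mult_right_mono[OF power_le_one[of s n] f0[of n]] s by simp
  have gS': "summable (\<lambda>n. g (Suc n))"
    by (rule summable_comparison_test'[OF f]) (use le gS f0 s in \<open>simp add: abs_mult\<close>)
  then have g: "summable g" by (simp add: summable_Suc_iff)
  then show c: "creation x \<in> fock_space s" by (simp add: fock_space_def g_def[abs_def])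
  have "suminf g = g 0 + (\<Sum>n. g (Suc n))" using suminf_split_head[OF g] by simp
  also have "g 0 = 0" by (simp add: g_def creation_def)
  also have "0 + (\<Sum>n. g (Suc n)) \<le> suminf f" using suminf_le[OF le gS' f] by simp
  finally show "fock_norm s (creation x) \<le> fock_norm s x"
    unfolding fock_norm_eq[OF s(1) x] fock_norm_eq[OF s(1) c]
    by (simp add: f_def[abs_def] g_def[abs_def])
qed

lemma annihilation_bounded:
  assumes s: "0 < s" "s \<le> 1" and x: "x \<in> fock_space s"
  shows "annihilation s x \<in> fock_space s" "fock_norm s (annihilation s x) \<le> fock_norm s x"
proof -
  define f where "f n = fock_weight s n * (cmod (x n))\<^sup>2" for n
  define g where "g n = fock_weight s n * (cmod (annihilation s x n))\<^sup>2" for n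
  have f: "summable f" using x by (simp add: fock_space_def f_def[abs_def])
  have geq: "g n = s ^ n * f (Suc n)" for n
    using s by (simp add: g_def f_def annihilation_def fock_weight_Suc norm_mult norm_power
        power_mult_distrib power2_eq_square)
  have f0: "0 \<le> f n" for n using fock_weight_pos[of s n] s by (simp add: f_def)
  have le: "g n \<le> f (Suc n)" for n
    unfolding geq using mult_right_mono[OF power_le_one[of s n] f0[of "Suc n"]] s by simp
  have fS: "summable (\<lambda>n. f (Suc n))" using f by (simp add: summable_Suc_iff)
  have g: "summable g"
    by (rule summable_comparison_test'[OF fS]) (use le geq f0 s in \<open>simp add: abs_mult\<close>)
  then show c: "annihilation s x \<in> fock_space s" by (simp add: fock_space_def g_def[abs_def])
  have "suminf g \<le> (\<Sum>n. f (Suc n))" by (rule suminf_le[OF le g fS])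
  also have "\<dots> \<le> suminf f" using suminf_split_head[OF f] f0[of 0] by simp
  finally show "fock_norm s (annihilation s x) \<le> fock_norm s x"
    unfolding fock_norm_eq[OF s(1) x] fock_norm_eq[OF s(1) c]
    by (simp add: f_def[abs_def] g_def[abs_def])
qed

lemma scalar_op_bounded:
  assumes s: "0 < s" "s \<le> 1" and x: "x \<in> fock_space s"
  shows "scalar_op s x \<in> fock_space s" "fock_norm s (scalar_op s x) \<le> fock_norm s x"
proof -
  have "cmod (scalar_op s x n) \<le> cmod (x n)" for n
    using s mult_right_mono[OF power_le_one[of s n], of "cmod (x n)"]
    by (simp add: scalar_op_def norm_mult norm_power)
  then have le: "fock_weight s n * (cmod (scalar_op s x n))\<^sup>2 \<le> fock_weight s n * (cmod (x n))\<^sup>2" for n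
    using fock_weight_pos[OF s(1), of n] by (simp add: power_mono)
  show "scalar_op s x \<in> fock_space s" "fock_norm s (scalar_op s x) \<le> fock_norm s x"
    by (rule fock_norm_le[OF s(1) x le])+
qed

lemma intermediate_bounded:
  assumes s: "0 < s" and t: "0 < t" "t \<le> 1" and x: "x \<in> fock_space s"
  shows "intermediate t x \<in> fock_space s" "fock_norm s (intermediate t x) \<le> fock_norm s x"
proof -
  have "cmod (intermediate t x n) \<le> cmod (x n)" for n
    using t mult_right_mono[OF power_le_one[of t "n - 1"], of "cmod (x n)"]
    by (simp add: intermediate_def norm_mult norm_power)
  then have le: "fock_weight s n * (cmod (intermediate t x n))\<^sup>2 \<le> fock_weight s n * (cmod (x n))\<^sup>2" for n
    using fock_weight_pos[OF s, of n] by (simp add: power_mono)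
  show "intermediate t x \<in> fock_space s" "fock_norm s (intermediate t x) \<le> fock_norm s x"
    by (rule fock_norm_le[OF s x le])+
qed

lemma annihilation_adjoint:
  assumes s: "0 < s" "s \<le> 1" and x: "x \<in> fock_space s" and y: "y \<in> fock_space s"
  shows "fock_inner s (creation x) y = fock_inner s x (annihilation s y)"
proof -
  define f where "f n = of_real (fock_weight s n) * (creation x n * cnj (y n))" for n
  have f: "summable f"
    unfolding f_def by (rule fock_inner_summable[OF s(1) creation_bounded(1)[OF s x] y])
  have "fock_inner s (creation x) y = suminf f" by (simp add: fock_inner_def f_def[abs_def])
  also have "\<dots> = f 0 + (\<Sum>n. f (Suc n))" using suminf_split_head[OF f] by simp
  also have "f 0 = 0" by (simp add: f_def creation_def)
  also have "(\<lambda>n. f (Suc n)) = (\<lambda>n. of_real (fock_weight s n) * (x n * cnj (annihilation s y n)))"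
    by (simp add: fun_eq_iff f_def creation_def annihilation_def fock_weight_Suc)
  finally show ?thesis by (simp add: fock_inner_def)
qed


lemma poisson_op_fock_space:
  assumes s: "0 < s" "s \<le> 1" and t: "0 < t" "t \<le> 1" and x: "x \<in> fock_space s"
  shows "poisson_op s t lam x \<in> fock_space s"
  unfolding poisson_op_def
  by (intro fock_space_add fock_space_scale s(1) creation_bounded(1)[OF s x]
      annihilation_bounded(1)[OF s x] scalar_op_bounded(1)[OF s x]
      intermediate_bounded(1)[OF s(1) t x])

lemma fock_inner_add_left:
  assumes s: "0 < s" and x: "x \<in> fock_space s" and y: "y \<in> fock_space s" and z: "z \<in> fock_space s"
  shows "fock_inner s (\<lambda>n. x n + y n) z = fock_inner s x z + fock_inner s y z"
  using suminf_add[OF fock_inner_summable[OF s x z] fock_inner_summable[OF s y z]]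
  by (simp add: fock_inner_def algebra_simps)

lemma fock_inner_scale_left:
  assumes s: "0 < s" and x: "x \<in> fock_space s" and z: "z \<in> fock_space s"
  shows "fock_inner s (\<lambda>n. c * x n) z = c * fock_inner s x z"
  using suminf_mult[OF fock_inner_summable[OF s x z], of c]
  by (simp add: fock_inner_def algebra_simps)

lemma fock_inner_commute:
  assumes s: "0 < s" and x: "x \<in> fock_space s" and y: "y \<in> fock_space s"
  shows "fock_inner s y x = cnj (fock_inner s x y)"
proof -
  have "(\<lambda>n. cnj (of_real (fock_weight s n) * (x n * cnj (y n)))) sums cnj (fock_inner s x y)"
    unfolding fock_inner_def sums_cnj by (rule summable_sums[OF fock_inner_summable[OF s x y]])
  then show ?thesis by (simp add: fock_inner_def sums_iff mult.commute)
qed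

lemma poisson_op_self_adjoint:
  assumes s: "0 < s" "s \<le> 1" and t: "0 < t" "t \<le> 1" and lam: "0 < lam"
    and x: "x \<in> fock_space s" and y: "y \<in> fock_space s"
  shows "fock_inner s (poisson_op s t lam x) y = fock_inner s x (poisson_op s t lam y)"
proof -
  note mem = creation_bounded(1)[OF s] annihilation_bounded(1)[OF s] scalar_op_bounded(1)[OF s]
    intermediate_bounded(1)[OF s(1) t] fock_space_scale fock_space_add[OF s(1)]
    poisson_op_fock_space[OF s t]
  have left: "fock_inner s (poisson_op s t lam u) v = fock_inner s (intermediate t u) v
      + of_real (sqrt lam) * (fock_inner s (creation u) v + fock_inner s (annihilation s u) v)
      + of_real lam * fock_inner s (scalar_op s u) v"
    if u: "u \<in> fock_space s" and v: "v \<in> fock_space s" for u v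
    unfolding poisson_op_def
    by (simp add: fock_inner_add_left[OF s(1)] fock_inner_scale_left[OF s(1)] mem u v)
  have ca: "fock_inner s (creation u) v = cnj (fock_inner s (annihilation s v) u)"
    if "u \<in> fock_space s" "v \<in> fock_space s" for u v
    using annihilation_adjoint[OF s that] fock_inner_commute[OF s(1) mem(2)[OF that(2)] that(1)]
    by simp
  have "x n * cnj (intermediate t y n) = intermediate t x n * cnj (y n)"
    "x n * cnj (scalar_op s y n) = scalar_op s x n * cnj (y n)" for n
    by (simp_all add: intermediate_def scalar_op_def)
  then have "fock_inner s x (intermediate t y) = fock_inner s (intermediate t x) y"
    "fock_inner s x (scalar_op s y) = fock_inner s (scalar_op s x) y"
    by (simp_all add: fock_inner_def)
  then have diag: "fock_inner s (intermediate t x) y = cnj (fock_inner s (intermediate t y) x)"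
    "fock_inner s (scalar_op s x) y = cnj (fock_inner s (scalar_op s y) x)"
    using fock_inner_commute[OF s(1) mem(4)[OF y] x] fock_inner_commute[OF s(1) mem(3)[OF y] x]
    by simp_all
  have "fock_inner s x (poisson_op s t lam y) = cnj (fock_inner s (poisson_op s t lam y) x)"
    by (rule fock_inner_commute[OF s(1) mem(7)[OF y] x])
  also have "\<dots> = fock_inner s (poisson_op s t lam x) y"
    unfolding left[OF x y] left[OF y x] using ca[OF x y] ca[OF y x] diag by (simp add: add.commute)
  finally show ?thesis by simp
qed


subsection \<open>Depth is constant on the blocks of a non-crossing partition\<close>

lemma dp_block:
  assumes \<pi>: "\<pi> \<in> NC n" and B: "B \<in> \<pi>" and ab: "a \<in> B" "b \<in> B"
  shows "dp \<pi> a = dp \<pi> b"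
proof -
  have P: "partition_on {1..n} \<pi>" and N: "noncrossing \<pi>" using \<pi> by (auto simp: NC_def)
  have *: "covers C v" if C: "C \<in> \<pi>" and u: "u \<in> B" and v: "v \<in> B" and cov: "covers C u" for C u v
  proof -
    have fin: "finite C"
      by (rule finite_subset[OF _ finite_atLeastAtMost[of 1 n]]) (use partition_onD1[OF P] C in blast)
    have ne: "C \<noteq> {}" using partition_onD3[OF P] C by auto
    have mm: "Min C \<in> C" "Max C \<in> C" using fin ne by auto
    have BC: "B \<noteq> C" using cov u by (auto simp: covers_def)
    then have dis: "B \<inter> C = {}"
      using partition_onD2[OF P] B C by (auto simp: disjoint_def)
    then have "Min C \<noteq> u" "Max C \<noteq> u" "Min C \<noteq> v" "Max C \<noteq> v" "v \<notin> C" using mm u v by auto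
    moreover have "Min C \<le> u" "u \<le> Max C" using cov by (auto simp: covers_def)
    ultimately have l: "Min C < u" "u < Max C" "Min C \<noteq> v" "Max C \<noteq> v" "v \<notin> C" by auto
    have "\<not> v < Min C"
    proof
      assume "v < Min C"
      then show False using N B C BC mm u v l(1,2) unfolding noncrossing_def by blast
    qed
    moreover have "\<not> Max C < v"
    proof
      assume "Max C < v"
      then show False using N B C BC mm u v l(1,2) unfolding noncrossing_def by metis
    qed
    ultimately show ?thesis using l by (auto simp: covers_def)
  qed
  have "{C \<in> \<pi>. covers C a} = {C \<in> \<pi>. covers C b}" using * ab by blast
  then show ?thesis by (simp add: dp_def)
qed

end

theory Submission
  imports Defs
begin

text \<open>
  For sets \<open>K < T\<close> consider the non-crossing partitions of \<open>K \<union> T\<close> in which every element of \<open>T\<close>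
  closes a block of size at least two; with \<open>T\<close> standing for the blocks still open after \<open>K\<close>, these
  are the partial partitions seen by a Motzkin path. Their total weight is
  \<open>sqrt \<lambda> ^ m * fock_weight s m\<close> times the \<open>m\<close>-th coordinate of \<open>P ^ k\<close> applied to the vacuum,
  where \<open>k = |K|\<close> and \<open>m = |T|\<close>, by induction on \<open>K\<close> along the four summands of \<open>P\<close>. The
  last element \<open>a\<close> of \<open>K\<close> is either a singleton (\<open>\<lambda>k\<^sub>s\<close>), or the opening of a block, which is
  then \<open>{a, Min T}\<close> (creation), or intermediate in the block of \<open>Min T\<close> (\<open>m\<^sub>t\<close>), or the end of its
  block, and then it moves into \<open>T\<close> (annihilation). In the first three cases deleting the block,
  respectively the element \<open>a\<close>, changes no depth elsewhere. The theorem is the case \<open>T = {}\<close>.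
\<close>

definition NC_closing :: "nat set \<Rightarrow> nat set \<Rightarrow> nat set set set" where
  "NC_closing K T = {\<pi>. partition_on (K \<union> T) \<pi> \<and> noncrossing \<pi> \<and>
     (\<forall>B\<in>\<pi>. \<forall>b\<in>B \<inter> T. (\<forall>x\<in>B. x \<le> b) \<and> (\<exists>x\<in>B. x < b))}"

text \<open>
  Here \<open>c\<close> and \<open>d\<close> are the size and depth of a block. As the truncated \<open>c - 2\<close> vanishes for
  \<open>c \<le> 2\<close>, \<open>td2\<close> needs no case distinction.
\<close>
definition block_weight :: "real \<Rightarrow> real \<Rightarrow> real \<Rightarrow> nat \<Rightarrow> nat \<Rightarrow> real" where
  "block_weight lam s t c d = lam * s ^ d * t ^ ((c - 2) * d)"

text \<open>Depth is read at the maximum throughout, although \<open>td2\<close> reads it at an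
  intermediate element. This gives a single product over blocks, from which one block can be split
  off.\<close>

definition NC_weight :: "real \<Rightarrow> real \<Rightarrow> real \<Rightarrow> nat set set \<Rightarrow> real" where
  "NC_weight lam s t \<pi> = (\<Prod>B\<in>\<pi>. block_weight lam s t (card B) (dp \<pi> (Max B)))"

section \<open>Covering and crossings\<close>

lemma covers_iff:
  assumes "finite C" "C \<noteq> {}"
  shows "covers C x \<longleftrightarrow> x \<notin> C \<and> (\<exists>u\<in>C. u < x) \<and> (\<exists>v\<in>C. x < v)"
proof
  assume "covers C x"
  then have "x \<notin> C" "Min C \<le> x" "x \<le> Max C" by (auto simp: covers_def)
  moreover have "Min C \<in> C" "Max C \<in> C" using assms by auto
  ultimately show "x \<notin> C \<and> (\<exists>u\<in>C. u < x) \<and> (\<exists>v\<in>C. x < v)"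
    by (metis le_neq_implies_less)
next
  assume "x \<notin> C \<and> (\<exists>u\<in>C. u < x) \<and> (\<exists>v\<in>C. x < v)"
  then show "covers C x"
    using assms unfolding covers_def by (meson Max.coboundedI Min.coboundedI le_less_trans less_imp_le order_trans)
qed

lemma noncrossingD:
  assumes "noncrossing \<pi>" "B \<in> \<pi>" "C \<in> \<pi>" "b1 \<in> B" "b2 \<in> B" "c1 \<in> C" "c2 \<in> C"
    "b1 < c1" "c1 < b2" "b2 < c2"
  shows "B = C"
  using assms unfolding noncrossing_def by blast

lemma noncrossingI:
  assumes "\<And>B C b1 b2 c1 c2. B \<in> \<pi> \<Longrightarrow> C \<in> \<pi> \<Longrightarrow> B \<noteq> C \<Longrightarrow> b1 \<in> B \<Longrightarrow> b2 \<in> B \<Longrightarrow>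
    c1 \<in> C \<Longrightarrow> c2 \<in> C \<Longrightarrow> b1 < c1 \<Longrightarrow> c1 < b2 \<Longrightarrow> b2 < c2 \<Longrightarrow> False"
  shows "noncrossing \<pi>"
  using assms unfolding noncrossing_def by blast

text \<open>Whichever role \<open>D\<close> plays in a crossing, an element of the other block lies
  strictly between two elements of \<open>D\<close>: \<open>c1\<close> if \<open>D\<close> comes
  first, \<open>b2\<close> if it comes second.\<close>

lemma noncrossing_insert:
  assumes "\<And>u v x. u \<in> D \<Longrightarrow> v \<in> D \<Longrightarrow> x \<in> \<Union>\<pi> \<Longrightarrow> u < x \<Longrightarrow> x < v \<Longrightarrow> False"
  shows "noncrossing (insert D \<pi>) \<longleftrightarrow> noncrossing \<pi>"
proof
  assume "noncrossing (insert D \<pi>)"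
  then show "noncrossing \<pi>" unfolding noncrossing_def by blast
next
  assume nc: "noncrossing \<pi>"
  show "noncrossing (insert D \<pi>)"
  proof (rule noncrossingI)
    fix B C b1 b2 c1 c2
    assume *: "B \<in> insert D \<pi>" "C \<in> insert D \<pi>" "B \<noteq> C" "b1 \<in> B" "b2 \<in> B"
      "c1 \<in> C" "c2 \<in> C" "b1 < c1" "c1 < b2" "b2 < c2"
    consider "B = D" "C \<in> \<pi>" | "C = D" "B \<in> \<pi>" | "B \<in> \<pi>" "C \<in> \<pi>" using * by blast
    then show False
    proof cases
      case 1
      then show ?thesis using assms[of b1 b2 c1] * by blast
    next
      case 2
      then show ?thesis using assms[of c1 c2 b2] * by blast
    next
      case 3
      then show ?thesis using noncrossingD[OF nc] * by blast
    qed
  qed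
qed

section \<open>Blocks and depths of partitions with closing elements\<close>

context
  fixes K T :: "nat set" and \<pi>
  assumes fin: "finite K" "finite T" and \<pi>: "\<pi> \<in> NC_closing K T"
begin

lemma closing_partition: "partition_on (K \<union> T) \<pi>"
  and closing_noncrossing: "noncrossing \<pi>"
  using \<pi> by (auto simp: NC_closing_def)

lemma closing_Union: "\<Union>\<pi> = K \<union> T"
  using partition_onD1[OF closing_partition] by simp

lemma closing_finite: "finite \<pi>"
  using finite_elements[OF _ closing_partition] fin by simp

lemma closing_block:
  assumes "B \<in> \<pi>"
  shows "finite B" "B \<noteq> {}" "B \<subseteq> K \<union> T"
proof -
  show "B \<subseteq> K \<union> T" using closing_Union assms by blast
  then show "finite B" by (rule finite_subset) (use fin in simp)
  show "B \<noteq> {}" using partition_onD3[OF closing_partition] assms by auto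
qed

lemma closing_Max: "B \<in> \<pi> \<Longrightarrow> Max B \<in> B"
  using closing_block by simp

lemma closing_unique: "B \<in> \<pi> \<Longrightarrow> C \<in> \<pi> \<Longrightarrow> x \<in> B \<Longrightarrow> x \<in> C \<Longrightarrow> B = C"
  using partition_onD2[OF closing_partition] by (auto simp: disjoint_def)

lemma closing_ge: "B \<in> \<pi> \<Longrightarrow> b \<in> B \<Longrightarrow> b \<in> T \<Longrightarrow> x \<in> B \<Longrightarrow> x \<le> b"
  using \<pi> by (auto simp: NC_closing_def)

lemma closing_Max_eq: "B \<in> \<pi> \<Longrightarrow> b \<in> B \<Longrightarrow> b \<in> T \<Longrightarrow> Max B = b"
  using closing_ge closing_block by (auto intro!: Max_eqI)

lemma closing_smaller:
  assumes "B \<in> \<pi>" "b \<in> B" "b \<in> T"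
  obtains x where "x \<in> B" "x < b" "x \<in> K"
proof -
  obtain x where x: "x \<in> B" "x < b" using \<pi> assms unfolding NC_closing_def by blast
  then have "x \<notin> T" using closing_ge[OF assms(1) x(1) _ assms(2)] by auto
  then show ?thesis using that x closing_block(3)[OF assms(1)] by blast
qed

text \<open>Taking maxima matches the blocks covering \<open>x\<close> with the closing elements
  beyond \<open>x\<close>: whatever lies after \<open>x\<close> is in \<open>T\<close>, and the
  block of a closing element starts in \<open>K\<close>, hence before \<open>x\<close>. If
  \<open>x\<close> itself is closing, its own block does not cover it, which is why \<open>x\<close>
  is removed from \<open>T\<close>.\<close>

lemma dp_closing:
  assumes K: "\<And>y. y \<in> K \<Longrightarrow> y < x" and T: "\<And>y. y \<in> T \<Longrightarrow> x \<le> y"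
  shows "dp \<pi> x = card (T - {x})"
proof -
  have "bij_betw Max {C \<in> \<pi>. covers C x} (T - {x})"
    unfolding bij_betw_def
  proof (intro conjI subset_antisym subsetI)
    show "inj_on Max {C \<in> \<pi>. covers C x}"
      by (rule inj_onI) (metis (mono_tags, lifting) closing_Max closing_unique mem_Collect_eq)
  next
    fix y assume "y \<in> Max ` {C \<in> \<pi>. covers C x}"
    then obtain C where C: "C \<in> \<pi>" "covers C x" "y = Max C" by auto
    have y: "y \<in> C" "x \<le> y" "x \<notin> C" using closing_Max C by (auto simp: covers_def)
    then have "x < y" by (metis le_neq_implies_less)
    moreover have "y \<in> K \<union> T" using closing_block(3)[OF C(1)] y by auto
    ultimately show "y \<in> T - {x}" using K[of y] by auto
  next
    fix y assume y: "y \<in> T - {x}"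
    then obtain C where C: "C \<in> \<pi>" "y \<in> C" using closing_Union by blast
    have My: "Max C = y" using closing_Max_eq C y by blast
    obtain z where z: "z \<in> C" "z \<in> K" using closing_smaller[OF C] y by blast
    have "x \<notin> C"
    proof
      assume xC: "x \<in> C"
      then have "x \<in> T" using closing_block(3)[OF C(1)] K[of x] by auto
      then show False using closing_Max_eq[OF C(1) xC] My y by auto
    qed
    moreover have "x < y" using T[of y] y by auto
    ultimately have "covers C x"
      using covers_iff[OF closing_block(1,2)[OF C(1)]] z K[of z] C by blast
    then show "y \<in> Max ` {C \<in> \<pi>. covers C x}" using C My by auto
  qed
  then show ?thesis unfolding dp_def by (rule bij_betw_same_card)
qed

end

section \<open>Deleting a whole block\<close>

lemma NC_closing_finite:
  assumes "finite K" "finite T" shows "finite (NC_closing K T)"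
  by (rule finite_subset[of _ "Pow (Pow (K \<union> T))"])
    (use assms in \<open>auto simp: NC_closing_def partition_on_def\<close>)

text \<open>Meant for \<open>D = {a}\<close> and \<open>D = {a, Min T}\<close>. Such a block is an
  interval of the ground set, so it can cross no other block.\<close>

lemma NC_closing_insert_iff:
  assumes D: "D \<noteq> {}" "D \<subseteq> K \<union> T" and dis: "D \<inter> \<Union>\<pi> = {}"
    and convex: "\<And>u v x. u \<in> D \<Longrightarrow> v \<in> D \<Longrightarrow> x \<in> (K \<union> T) - D \<Longrightarrow> u < x \<Longrightarrow> x < v \<Longrightarrow> False"
    and closing: "\<And>b. b \<in> D \<inter> T \<Longrightarrow> (\<forall>x\<in>D. x \<le> b) \<and> (\<exists>x\<in>D. x < b)"
  shows "insert D \<pi> \<in> NC_closing K T \<longleftrightarrow> \<pi> \<in> NC_closing (K - D) (T - D)"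
proof -
  have *: "partition_on (K \<union> T) (insert D \<pi>) \<longleftrightarrow> partition_on ((K - D) \<union> (T - D)) \<pi>"
    using D dis by (subst partition_on_insert) (auto simp: disjnt_def Un_Diff)
  moreover have "noncrossing (insert D \<pi>) \<longleftrightarrow> noncrossing \<pi>"
    if "partition_on ((K - D) \<union> (T - D)) \<pi>"
    by (rule noncrossing_insert) (use convex partition_onD1[OF that] in blast)
  moreover have "B \<inter> T = B \<inter> (T - D)" if "B \<in> \<pi>" for B using dis that by blast
  ultimately show ?thesis unfolding NC_closing_def using closing by auto
qed

text \<open>An interval block covers no element of the ground set, so every depth is unchanged and
  the product only gains the factor of \<open>D\<close>.\<close>

lemma NC_weight_insert:
  assumes fin: "finite K" "finite T" and \<pi>: "\<pi> \<in> NC_closing K T"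
    and D: "finite D" "D \<noteq> {}" "D \<inter> (K \<union> T) = {}"
    and convex: "\<And>u v x. u \<in> D \<Longrightarrow> v \<in> D \<Longrightarrow> x \<in> K \<union> T \<Longrightarrow> u < x \<Longrightarrow> x < v \<Longrightarrow> False"
  shows "NC_weight lam s t (insert D \<pi>)
    = block_weight lam s t (card D) (dp \<pi> (Max D)) * NC_weight lam s t \<pi>"
proof -
  note cl = closing_block[OF fin \<pi>]
  have nD: "D \<notin> \<pi>" using cl D by blast
  have "\<not> covers D x" if "x \<in> D \<union> (K \<union> T)" for x
    using that convex covers_iff[OF D(1,2)] by blast
  then have dp: "dp (insert D \<pi>) x = dp \<pi> x" if "x \<in> D \<union> (K \<union> T)" for x
    using that by (auto simp: dp_def intro: arg_cong[where f = card])
  have "dp (insert D \<pi>) (Max B) = dp \<pi> (Max B)" if "B \<in> \<pi>" for B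
    using closing_Max[OF fin \<pi> that] cl(3)[OF that] by (intro dp) blast
  moreover have "dp (insert D \<pi>) (Max D) = dp \<pi> (Max D)" using D by (intro dp) simp
  ultimately show ?thesis
    unfolding NC_weight_def using nD closing_finite[OF fin \<pi>] by simp
qed

text \<open>Deleting \<open>D\<close> is a bijection. Once it is gone, \<open>Max D\<close> lies
  after all remaining free elements and before all remaining closing ones, so by
  \<open>dp_closing\<close> its depth is the same for every partition and the factor leaves the
  sum.\<close>

lemma sum_NC_closing_insert:
  assumes fin: "finite K" "finite T"
    and D: "D \<noteq> {}" "D \<subseteq> K \<union> T"
    and convex: "\<And>u v x. u \<in> D \<Longrightarrow> v \<in> D \<Longrightarrow> x \<in> (K \<union> T) - D \<Longrightarrow> u < x \<Longrightarrow> x < v \<Longrightarrow> False"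
    and closing: "\<And>b. b \<in> D \<inter> T \<Longrightarrow> (\<forall>x\<in>D. x \<le> b) \<and> (\<exists>x\<in>D. x < b)"
    and Max: "\<And>y. y \<in> K - D \<Longrightarrow> y < Max D" "\<And>y. y \<in> T - D \<Longrightarrow> Max D < y"
  shows "(\<Sum>\<pi>\<in>{\<pi> \<in> NC_closing K T. D \<in> \<pi>}. NC_weight lam s t \<pi>)
    = block_weight lam s t (card D) (card (T - D)) * (\<Sum>\<pi>\<in>NC_closing (K - D) (T - D). NC_weight lam s t \<pi>)"
proof -
  have fin': "finite (K - D)" "finite (T - D)" "finite D"
    using fin finite_subset[OF D(2)] by auto
  have "(\<Sum>\<pi>\<in>{\<pi> \<in> NC_closing K T. D \<in> \<pi>}. NC_weight lam s t \<pi>)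
    = (\<Sum>\<pi>\<in>NC_closing (K - D) (T - D).
         block_weight lam s t (card D) (card (T - D)) * NC_weight lam s t \<pi>)"
  proof (rule sum.reindex_bij_witness[of _ "insert D" "\<lambda>\<pi>. \<pi> - {D}"])
    fix \<pi> assume "\<pi> \<in> {\<pi> \<in> NC_closing K T. D \<in> \<pi>}"
    then have \<pi>: "\<pi> \<in> NC_closing K T" "D \<in> \<pi>" by auto
    show eq: "insert D (\<pi> - {D}) = \<pi>" using \<pi> by auto
    have "D \<inter> \<Union>(\<pi> - {D}) = {}" using closing_unique[OF fin \<pi>(1) _ \<pi>(2)] by blast
    then show \<pi>': "\<pi> - {D} \<in> NC_closing (K - D) (T - D)"
      using NC_closing_insert_iff[OF D _ convex closing, of "\<pi> - {D}"] \<pi> eq by simp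
    have "dp (\<pi> - {D}) (Max D) = card (T - D - {Max D})"
      by (rule dp_closing[OF fin'(1,2) \<pi>']) (use Max in \<open>auto intro: less_imp_le\<close>)
    also have "T - D - {Max D} = T - D" using fin'(3) D(1) by auto
    finally have dp: "dp (\<pi> - {D}) (Max D) = card (T - D)" .
    have "NC_weight lam s t (insert D (\<pi> - {D})) =
      block_weight lam s t (card D) (dp (\<pi> - {D}) (Max D)) * NC_weight lam s t (\<pi> - {D})"
      by (rule NC_weight_insert[OF fin'(1,2) \<pi>' fin'(3) D(1)]) (use convex in auto)
    then show "block_weight lam s t (card D) (card (T - D)) * NC_weight lam s t (\<pi> - {D})
      = NC_weight lam s t \<pi>"
      by (simp only: eq dp)
  next
    fix \<pi> assume \<pi>: "\<pi> \<in> NC_closing (K - D) (T - D)"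
    have U: "D \<inter> \<Union>\<pi> = {}" using closing_Union[OF fin'(1,2) \<pi>] by auto
    show "insert D \<pi> - {D} = \<pi>" using U D(1) by auto
    show "insert D \<pi> \<in> {\<pi> \<in> NC_closing K T. D \<in> \<pi>}"
      using NC_closing_insert_iff[OF D U convex closing] \<pi> by simp
  qed
  then show ?thesis by (simp add: sum_distrib_left)
qed

section \<open>Deleting an intermediate element\<close>

text \<open>Deleting \<open>a\<close> shortens the block of \<open>b\<close> by one and leaves its
  extrema and all depths alone. That block has depth \<open>card T - 1\<close>, so exactly
  \<open>t ^ (card T - 1)\<close> is lost.\<close>

lemma sum_NC_closing_mid:
  fixes a b :: nat
  assumes fin: "finite K" "finite T" and K: "\<And>y. y \<in> K \<Longrightarrow> y < a" and T: "\<And>y. y \<in> T \<Longrightarrow> b \<le> y"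
    and ab: "a < b" "b \<in> T"
  shows "(\<Sum>\<pi>\<in>{\<pi> \<in> NC_closing (insert a K) T. \<exists>B\<in>\<pi>. a \<in> B \<and> b \<in> B \<and> (\<exists>x\<in>B. x < a)}.
      NC_weight lam s t \<pi>)
    = t ^ (card T - 1) * (\<Sum>\<pi>\<in>NC_closing K T. NC_weight lam s t \<pi>)" (is "sum _ ?L = _")
proof -
  have aT: "a \<notin> K \<union> T" using K T ab(1) by fastforce
  define g where "g C = (if b \<in> C then insert a C else C)" for C :: "nat set"
  define h where "h C = C - {a}" for C :: "nat set"
  have fin': "finite (insert a K)" using fin by simp
  have hg: "h (g C) = C" if "a \<notin> C" for C using that by (auto simp: h_def g_def)
  have "(\<Sum>\<pi>\<in>NC_closing K T. t ^ (card T - 1) * NC_weight lam s t \<pi>)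
    = (\<Sum>\<pi>\<in>?L. NC_weight lam s t \<pi>)"
  proof (rule sum.reindex_bij_witness[of _ "image h" "image g"])
    fix \<pi> assume "\<pi> \<in> ?L"
    then obtain B where \<pi>: "\<pi> \<in> NC_closing (insert a K) T"
      and B: "B \<in> \<pi>" "a \<in> B" "b \<in> B" "\<exists>x\<in>B. x < a" by auto
    note cl = closing_block[OF fin' fin(2) \<pi>] and uniq = closing_unique[OF fin' fin(2) \<pi>]
    have ba: "b \<noteq> a" using ab by simp
    have "g (h C) = C" if "C \<in> \<pi>" for C
      using uniq[OF that B(1)] B ba by (auto simp: g_def h_def)
    then show "g ` h ` \<pi> = \<pi>" by (auto simp: image_iff)
    have h: "h C \<subseteq> C" for C by (auto simp: h_def)
    have "partition_on (K \<union> T) (h ` \<pi>)"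
      unfolding partition_on_def
    proof (intro conjI)
      show "\<Union>(h ` \<pi>) = K \<union> T"
        using closing_Union[OF fin' fin(2) \<pi>] aT by (auto simp: h_def)
      show "disjoint (h ` \<pi>)"
        using uniq h unfolding disjoint_def by blast
      have "h C \<noteq> {}" if "C \<in> \<pi>" for C
      proof (cases "a \<in> C")
        case True
        then have "C = B" using uniq that B by blast
        then show ?thesis using B ba by (auto simp: h_def)
      qed (use cl(2)[OF that] in \<open>auto simp: h_def\<close>)
      then show "{} \<notin> h ` \<pi>" by auto
    qed
    moreover have "noncrossing (h ` \<pi>)"
    proof (rule noncrossingI)
      fix B C b1 b2 c1 c2
      assume "B \<in> h ` \<pi>" "C \<in> h ` \<pi>" "B \<noteq> C" "b1 \<in> B" "b2 \<in> B"
        "c1 \<in> C" "c2 \<in> C" "b1 < c1" "c1 < b2" "b2 < c2"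
      then show False
        using noncrossingD[OF closing_noncrossing[OF fin' fin(2) \<pi>]] h by blast
    qed
    moreover have "(\<forall>x\<in>h C. x \<le> c) \<and> (\<exists>x\<in>h C. x < c)" if "C \<in> \<pi>" "c \<in> h C \<inter> T" for C c
    proof
      have c: "c \<in> C" "c \<in> T" using that by (auto simp: h_def)
      show "\<forall>x\<in>h C. x \<le> c" using closing_ge[OF fin' fin(2) \<pi> that(1) c] h by blast
      \<comment> \<open>The block that loses \<open>a\<close> keeps the element below
        \<open>a\<close> required in \<open>?L\<close>, so it still has at least two
        elements.\<close>
      show "\<exists>x\<in>h C. x < c"
      proof (cases "a \<in> C")
        case True
        then have "C = B" using uniq that B by blast
        then obtain x where "x \<in> C" "x < a" using B by auto
        moreover have "a < c" using T[OF c(2)] ab by simp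
        ultimately show ?thesis by (auto simp: h_def intro!: bexI[of _ x])
      next
        case False
        then show ?thesis using closing_smaller[OF fin' fin(2) \<pi> that(1) c]
          by (auto simp: h_def)
      qed
    qed
    ultimately show "h ` \<pi> \<in> NC_closing K T" by (auto simp: NC_closing_def)
  next
    fix \<pi> assume \<pi>: "\<pi> \<in> NC_closing K T"
    note cl = closing_block[OF fin \<pi>] and uniq = closing_unique[OF fin \<pi>]
    have na: "a \<notin> C" if "C \<in> \<pi>" for C using cl(3)[OF that] aT by auto
    show "h ` g ` \<pi> = \<pi>" using hg na by (force simp: image_iff)
    obtain B where B: "B \<in> \<pi>" "b \<in> B" using closing_Union[OF fin \<pi>] ab by blast
    obtain x where x: "x \<in> B" "x < b" "x \<in> K"
      using closing_smaller[OF fin \<pi> B ab(2)] by blast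
    have gC: "g C = C" if "C \<in> \<pi>" "C \<noteq> B" for C using uniq[of C B b] that B by (auto simp: g_def)
    have gB: "g B = insert a B" using B by (simp add: g_def)
    have "partition_on (insert a K \<union> T) (g ` \<pi>)"
      unfolding partition_on_def
    proof (intro conjI)
      have "\<Union>(g ` \<pi>) = insert a (\<Union>\<pi>)" using B by (auto simp: g_def split: if_splits)
      then show "\<Union>(g ` \<pi>) = insert a K \<union> T" using closing_Union[OF fin \<pi>] by auto
      have "g C \<inter> g D = {}" if "C \<in> \<pi>" "D \<in> \<pi>" "C \<noteq> D" for C D
        using uniq[OF that(1,2)] that(3) na[OF that(1)] na[OF that(2)] by (auto simp: g_def)
      then show "disjoint (g ` \<pi>)" unfolding disjoint_def by blast
      show "{} \<notin> g ` \<pi>" using cl(2) by (auto simp: g_def)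
    qed
    \<comment> \<open>Nothing in the ground set lies strictly between \<open>a\<close> and
      \<open>b\<close>, and \<open>B\<close> ends in \<open>b\<close>. Hence in a crossing
      \<open>a\<close> can only be the larger of the two elements taken from the enlarged block, and
      replacing it by \<open>b\<close> gives a crossing in \<open>\<pi>\<close>.\<close>
    moreover have "noncrossing (g ` \<pi>)"
    proof (rule noncrossingI)
      fix C' D' b1 b2 c1 c2
      assume *: "C' \<in> g ` \<pi>" "D' \<in> g ` \<pi>" "C' \<noteq> D'" "b1 \<in> C'" "b2 \<in> C'"
        "c1 \<in> D'" "c2 \<in> D'" "b1 < c1" "c1 < b2" "b2 < c2"
      then obtain C D where CD: "C \<in> \<pi>" "D \<in> \<pi>" "C' = g C" "D' = g D" "C \<noteq> D" by auto
      note nc = noncrossingD[OF closing_noncrossing[OF fin \<pi>] CD(1,2)]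
      have between: "y < a \<or> b \<le> y" if "E \<in> \<pi>" "y \<in> E" for y E
        using cl(3)[OF that(1)] that K[of y] T[of y] by blast
      consider "C = B" "D \<noteq> B" | "D = B" "C \<noteq> B" | "C \<noteq> B" "D \<noteq> B" using CD(5) by blast
      then show False
      proof cases
        case 1
        then have C': "C' = insert a B" "D' = D" using CD gB gC by auto
        have c: "c1 \<in> D" "c2 \<in> D" "c1 \<noteq> b" "c2 \<noteq> b"
          using * C' CD 1 uniq[of D B b] B by auto
        have b2: "b2 \<le> b" using * C' ab closing_ge[OF fin \<pi> B ab(2)] by auto
        have c1: "c1 < a" using between[OF CD(2) c(1)] c b2 * by auto
        then have b1: "b1 \<in> B" using * C' by auto
        have c2: "b < c2 \<or> c2 < a" using between[OF CD(2) c(2)] c by auto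
        show False
        proof (cases "b2 = a")
          case True
          then show False using nc[of b1 b c1 c2] b1 B 1 c c1 c2 * ab CD(5) by auto
        next
          case False
          then show False using nc[of b1 b2 c1 c2] b1 1 c * CD(5) C' by auto
        qed
      next
        case 2
        then have C': "D' = insert a B" "C' = C" using CD gB gC by auto
        have c: "b1 \<in> C" "b2 \<in> C" "b1 \<noteq> b" "b2 \<noteq> b"
          using * C' CD 2 uniq[of C B b] B by auto
        have c2: "c2 \<le> b" using * C' ab closing_ge[OF fin \<pi> B ab(2)] by auto
        have b2: "b2 < a" using between[OF CD(1) c(2)] c c2 * by auto
        then have c1: "c1 \<in> B" using * C' by auto
        show False using nc[of b1 b2 c1 b] c1 b2 B 2 c * ab CD(5) by auto
      next
        case 3
        then show False using nc[of b1 b2 c1 c2] * CD gC by auto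
      qed
    qed
    moreover have "(\<forall>y\<in>g C. y \<le> c) \<and> (\<exists>y\<in>g C. y < c)" if "C \<in> \<pi>" "c \<in> g C \<inter> T" for C c
    proof -
      have c: "c \<in> C" "c \<in> T" using that aT by (auto simp: g_def split: if_splits)
      then have "a < c" using T[OF c(2)] ab by auto
      then show ?thesis using closing_ge[OF fin \<pi> that(1) c] closing_smaller[OF fin \<pi> that(1) c]
        by (auto simp: g_def)
    qed
    moreover have "\<exists>C\<in>g ` \<pi>. a \<in> C \<and> b \<in> C \<and> (\<exists>x\<in>C. x < a)"
      using B x K[OF x(3)] gB by (intro bexI[of _ "g B"]) auto
    ultimately show "g ` \<pi> \<in> ?L" by (auto simp: NC_closing_def)
    have inj: "inj_on g \<pi>" by (rule inj_on_inverseI[of _ h]) (use hg na in auto)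
    \<comment> \<open>Since \<open>x < a < b\<close> with \<open>x\<close> and \<open>b\<close> in
      \<open>B\<close>, the new element is not extremal in the enlarged block.\<close>
    have cov: "covers (g C) y = covers C y" if "C \<in> \<pi>" "y \<in> K \<union> T" for C y
    proof (cases "C = B")
      case True
      have "y < a \<or> b \<le> y" using that K T by blast
      then show ?thesis
        unfolding True gB using covers_iff[OF cl(1,2)[OF B(1)], of y]
          covers_iff[of "insert a B" y] cl(1)[OF B(1)] B x K[OF x(3)] ab(1)
        by (auto intro: order.strict_trans)
    qed (use gC that in simp)
    have dp: "dp (g ` \<pi>) y = dp \<pi> y" if "y \<in> K \<union> T" for y
    proof -
      have "{C \<in> g ` \<pi>. covers C y} = g ` {C \<in> \<pi>. covers C y}" using cov that by auto
      then show ?thesis unfolding dp_def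
        by (simp add: card_image inj_on_subset[OF inj])
    qed
    have MB: "Max B = b" using closing_Max_eq[OF fin \<pi> B ab(2)] .
    have MgB: "Max (insert a B) = b" using MB cl(1,2)[OF B(1)] ab by simp
    have MC: "Max C \<in> K \<union> T" if "C \<in> \<pi>" for C
      using closing_Max[OF fin \<pi> that] cl(3)[OF that] by auto
    \<comment> \<open>Every closing element other than \<open>b\<close> ends a block covering
      \<open>b\<close>; the block of \<open>b\<close> itself accounts for the
      \<open>- 1\<close>.\<close>
    have dpb: "dp \<pi> b = card T - 1"
      using dp_closing[OF fin \<pi>, of b] K T ab fin by fastforce
    \<comment> \<open>Only from size two on does one more element raise the truncated
      \<open>card B - 2\<close> by one.\<close>
    have cB: "card B \<ge> 2"
      using card_mono[OF cl(1)[OF B(1)], of "{x, b}"] x B by auto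
    have bw: "block_weight lam s t (Suc (card B)) d = t ^ d * block_weight lam s t (card B) d" for d
    proof -
      have "Suc (card B) - 2 = Suc (card B - 2)" using cB by simp
      then show ?thesis by (simp add: block_weight_def power_add)
    qed
    have "NC_weight lam s t (g ` \<pi>) =
      (\<Prod>C\<in>\<pi>. block_weight lam s t (card (g C)) (dp (g ` \<pi>) (Max (g C))))"
      unfolding NC_weight_def by (simp add: prod.reindex[OF inj])
    also have "\<dots> = (\<Prod>C\<in>\<pi>. (if C = B then t ^ (card T - 1) else 1)
        * block_weight lam s t (card C) (dp \<pi> (Max C)))"
    proof (rule prod.cong[OF refl])
      fix C assume C: "C \<in> \<pi>"
      show "block_weight lam s t (card (g C)) (dp (g ` \<pi>) (Max (g C)))
        = (if C = B then t ^ (card T - 1) else 1) * block_weight lam s t (card C) (dp \<pi> (Max C))"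
        using dp[OF MC[OF C]] gC[OF C] gB MB MgB na[OF B(1)] cl(1)[OF B(1)] bw dpb
        by (cases "C = B") auto
    qed
    also have "\<dots> = t ^ (card T - 1) * NC_weight lam s t \<pi>"
      unfolding prod.distrib NC_weight_def using closing_finite[OF fin \<pi>] B(1) by simp
    finally show "NC_weight lam s t (g ` \<pi>) = t ^ (card T - 1) * NC_weight lam s t \<pi>" .
  qed
  then show ?thesis by (simp add: sum_distrib_left)
qed


section \<open>The recursion on the last free element\<close>

text \<open>This is the annihilation case: that \<open>a\<close> ends a block of size at least two
  is precisely the condition imposed on a closing element, so moving \<open>a\<close> into
  \<open>T\<close> leaves the partition itself unchanged.\<close>

lemma NC_closing_insert_Max:
  assumes fin: "finite K" "finite T" and K: "\<And>y. y \<in> K \<Longrightarrow> y < a" and T: "\<And>y. y \<in> T \<Longrightarrow> a < y"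
  shows "NC_closing K (insert a T)
    = {\<pi> \<in> NC_closing (insert a K) T. \<exists>B\<in>\<pi>. a \<in> B \<and> (\<forall>x\<in>B. x \<le> a) \<and> (\<exists>x\<in>B. x < a)}"
    (is "?L = ?R")
proof (intro subset_antisym subsetI)
  fix \<pi> assume \<pi>: "\<pi> \<in> ?L"
  obtain B where B: "B \<in> \<pi>" "a \<in> B" using closing_Union[OF _ _ \<pi>] fin by auto
  show "\<pi> \<in> ?R" using \<pi> B unfolding NC_closing_def by auto
next
  fix \<pi> assume "\<pi> \<in> ?R"
  then obtain B where \<pi>: "\<pi> \<in> NC_closing (insert a K) T"
    and B: "B \<in> \<pi>" "a \<in> B" "\<forall>x\<in>B. x \<le> a" "\<exists>x\<in>B. x < a" by auto
  have "C = B" if "C \<in> \<pi>" "a \<in> C" for C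
    using closing_unique[OF _ fin(2) \<pi> that(1) B(1) that(2) B(2)] fin by simp
  then show "\<pi> \<in> ?L" using \<pi> B(3,4) unfolding NC_closing_def by auto
qed

text \<open>
  A block containing the last free element \<open>a\<close> and some later element must contain the smallest
  closing element: otherwise the block of the latter, which starts before \<open>a\<close>, would cross it.
\<close>
lemma NC_closing_block_Min:
  assumes fin: "finite K" "finite T" and K: "\<And>y. y \<in> K \<Longrightarrow> y < a" and T: "\<And>y. y \<in> T \<Longrightarrow> a < y"
    and \<pi>: "\<pi> \<in> NC_closing (insert a K) T" and B: "B \<in> \<pi>" "a \<in> B" "x \<in> B" "a < x"
  shows "T \<noteq> {}" "Min T \<in> B"
proof -
  have fin': "finite (insert a K)" using fin by simp
  have x: "x \<in> T" using closing_block(3)[OF fin' fin(2) \<pi> B(1)] B(3,4) K[of x] by auto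
  then show ne: "T \<noteq> {}" by auto
  define b where "b = Min T"
  have b: "b \<in> T" "b \<le> x" using fin(2) ne x by (auto simp: b_def)
  obtain C where C: "C \<in> \<pi>" "b \<in> C" using closing_Union[OF fin' fin(2) \<pi>] b by blast
  obtain u where u: "u \<in> C" "u \<in> insert a K" using closing_smaller[OF fin' fin(2) \<pi> C b(1)] by blast
  have "C = B"
  proof (cases "u = a \<or> b = x")
    case True
    then show ?thesis using closing_unique[OF fin' fin(2) \<pi>] C B u by blast
  next
    case False
    then show ?thesis
      using noncrossingD[OF closing_noncrossing[OF fin' fin(2) \<pi>] C(1) B(1) u(1) C(2) B(2,3)]
        u(2) K[of u] T[OF b(1)] b(2) by auto
  qed
  then show "Min T \<in> B" using C(2) by (simp add: b_def)
qed

lemma sum_NC_closing_step: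
  fixes lam s t :: real
  assumes fin: "finite K" "finite T" and K: "\<And>y. y \<in> K \<Longrightarrow> y < a" and T: "\<And>y. y \<in> T \<Longrightarrow> a < y"
  defines "S \<equiv> \<lambda>K T. \<Sum>\<pi>\<in>NC_closing K T. NC_weight lam s t \<pi>"
  shows "S (insert a K) T = S K (insert a T) + lam * s ^ card T * S K T
    + (if T = {} then 0
       else lam * s ^ (card T - 1) * S K (T - {Min T}) + t ^ (card T - 1) * S K T)"
proof -
  \<comment> \<open>For empty \<open>T\<close> this value is arbitrary; \<open>A2\<close> and
    \<open>A3\<close> enter the count only when \<open>T\<close> is nonempty.\<close>
  define b where "b = Min T"
  let ?w = "NC_weight lam s t"
  let ?G = "NC_closing (insert a K) T"
  \<comment> \<open>In \<open>A1\<close> to \<open>A4\<close> the element \<open>a\<close> is a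
    singleton, first, intermediate or last in its block, matching \<open>scalar_op\<close>,
    \<open>creation\<close>, \<open>intermediate\<close> and \<open>annihilation\<close>.\<close>
  define A1 where "A1 = {\<pi> \<in> ?G. {a} \<in> \<pi>}"
  define A2 where "A2 = {\<pi> \<in> ?G. {a, b} \<in> \<pi>}"
  define A3 where "A3 = {\<pi> \<in> ?G. \<exists>B\<in>\<pi>. a \<in> B \<and> b \<in> B \<and> (\<exists>x\<in>B. x < a)}"
  define A4 where "A4 = {\<pi> \<in> ?G. \<exists>B\<in>\<pi>. a \<in> B \<and> (\<forall>x\<in>B. x \<le> a) \<and> (\<exists>x\<in>B. x < a)}"
  note defs = A1_def A2_def A3_def A4_def
  have fin': "finite (insert a K)" using fin by simp
  have aK: "a \<notin> K" "a \<notin> T" using K T by blast+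
  have finG: "finite A1" "finite A2" "finite A3" "finite A4"
    using NC_closing_finite[OF fin' fin(2)] by (auto simp: defs)
  have uniq: "B = C" if "\<pi> \<in> ?G" "B \<in> \<pi>" "C \<in> \<pi>" "a \<in> B" "a \<in> C" for \<pi> B C
    using closing_unique[OF fin' fin(2) that] .
  have s4: "sum ?w A4 = S K (insert a T)"
    unfolding A4_def S_def using NC_closing_insert_Max[OF fin K T] by simp
  have "sum ?w A1 = block_weight lam s t (card {a}) (card (T - {a})) * S (insert a K - {a}) (T - {a})"
    unfolding A1_def S_def
    by (rule sum_NC_closing_insert[OF fin' fin(2)]) (use K T aK in auto)
  then have s1: "sum ?w A1 = lam * s ^ card T * S K T"
    using aK by (simp add: block_weight_def)
  have d14: "A1 \<inter> A4 = {}" using uniq by (fastforce simp: defs)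
  show ?thesis
  proof (cases "T = {}")
    case True
    have "?G = A1 \<union> A4"
    proof (intro subset_antisym subsetI)
      fix \<pi> assume \<pi>: "\<pi> \<in> ?G"
      obtain B where B: "B \<in> \<pi>" "a \<in> B" using closing_Union[OF fin' fin(2) \<pi>] by auto
      have le: "\<forall>x\<in>B. x \<le> a"
        using NC_closing_block_Min(1)[OF fin K T \<pi> B] True by (meson not_le)
      show "\<pi> \<in> A1 \<union> A4"
      proof (cases "\<exists>x\<in>B. x < a")
        case False
        then have "B = {a}" using le B(2) by (auto simp: not_less intro: antisym)
        then show ?thesis using \<pi> B by (auto simp: defs)
      qed (use \<pi> B le in \<open>auto simp: defs\<close>)
    qed (auto simp: defs)
    then have "S (insert a K) T = sum ?w A1 + sum ?w A4"
      unfolding S_def using d14 finG by (simp add: sum.union_disjoint)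
    then show ?thesis using s1 s4 True by simp
  next
    case False
    have b: "b \<in> T" "a < b" "\<And>y. y \<in> T \<Longrightarrow> b \<le> y" using False T fin by (auto simp: b_def)
    have "sum ?w A2 = block_weight lam s t (card {a, b}) (card (T - {a, b}))
        * S (insert a K - {a, b}) (T - {a, b})"
      unfolding A2_def S_def
    proof (rule sum_NC_closing_insert[OF fin' fin(2)])
      show "\<And>u v x. u \<in> {a, b} \<Longrightarrow> v \<in> {a, b} \<Longrightarrow> x \<in> (insert a K \<union> T) - {a, b} \<Longrightarrow>
          u < x \<Longrightarrow> x < v \<Longrightarrow> False"
        using K b by fastforce
    qed (use K aK b in \<open>force+\<close>)
    moreover have "insert a K - {a, b} = K" "T - {a, b} = T - {b}" using aK b K[of b] by auto
    ultimately have s2: "sum ?w A2 = lam * s ^ (card T - 1) * S K (T - {b})"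
      using b fin by (simp add: block_weight_def)
    have s3: "sum ?w A3 = t ^ (card T - 1) * S K T"
      unfolding A3_def S_def by (rule sum_NC_closing_mid[OF fin K b(3,2,1)])
    have d: "A1 \<inter> A2 = {}" "A1 \<inter> A3 = {}" "A2 \<inter> A3 = {}" "A2 \<inter> A4 = {}" "A3 \<inter> A4 = {}"
    proof -
      have *: False if "\<pi> \<in> ?G" "B \<in> \<pi>" "C \<in> \<pi>" "a \<in> B" "a \<in> C" "B \<noteq> C" for \<pi> B C
        using uniq that by blast
      show "A1 \<inter> A2 = {}" using *[of _ "{a}" "{a, b}"] b(2) by (auto simp: defs)
      show "A1 \<inter> A3 = {}" using *[of _ "{a}"] b(2) by (fastforce simp: defs)
      show "A2 \<inter> A3 = {}" using *[of _ "{a, b}"] b(2) by (fastforce simp: defs)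
      show "A2 \<inter> A4 = {}" using *[of _ "{a, b}"] b(2) by (fastforce simp: defs)
      show "A3 \<inter> A4 = {}"
      proof (rule equals0I)
        fix \<pi> assume "\<pi> \<in> A3 \<inter> A4"
        then obtain B C where "\<pi> \<in> ?G" "B \<in> \<pi>" "C \<in> \<pi>" "a \<in> B" "a \<in> C" "b \<in> B" "\<forall>x\<in>C. x \<le> a"
          by (auto simp: defs)
        then show False using uniq b(2) by (metis not_le)
      qed
    qed
    have "?G = A1 \<union> A2 \<union> A3 \<union> A4"
    proof (intro subset_antisym subsetI)
      fix \<pi> assume \<pi>: "\<pi> \<in> ?G"
      obtain B where B: "B \<in> \<pi>" "a \<in> B" using closing_Union[OF fin' fin(2) \<pi>] by auto
      show "\<pi> \<in> A1 \<union> A2 \<union> A3 \<union> A4"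
      proof (cases "\<exists>x\<in>B. a < x")
        case True
        then have bB: "b \<in> B" using NC_closing_block_Min(2)[OF fin K T \<pi> B] by (auto simp: b_def)
        show ?thesis
        proof (cases "\<exists>x\<in>B. x < a")
          case True
          then show ?thesis using \<pi> B bB by (auto simp: defs)
        next
          case False
          \<comment> \<open>Elements of \<open>B\<close> other than \<open>a\<close> lie in
            \<open>T\<close>, hence are at least \<open>b\<close>; and \<open>b\<close> closes
            \<open>B\<close>, so they are at most \<open>b\<close>.\<close>
          have "x = a \<or> x = b" if "x \<in> B" for x
          proof -
            have "x \<in> insert a K \<union> T" using closing_block(3)[OF fin' fin(2) \<pi> B(1)] that by auto
            moreover have "x \<notin> K" using K[of x] False that by auto
            moreover have "x \<le> b" by (rule closing_ge[OF fin' fin(2) \<pi> B(1) bB b(1) that])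
            ultimately show ?thesis using b(3)[of x] by auto
          qed
          then have "B = {a, b}" using B bB by auto
          then show ?thesis using \<pi> B by (auto simp: defs)
        qed
      next
        case le: False
        show ?thesis
        proof (cases "\<exists>x\<in>B. x < a")
          case False
          then have "B = {a}" using le B(2) by (auto simp: not_less intro: antisym)
          then show ?thesis using \<pi> B by (auto simp: defs)
        qed (use \<pi> B le in \<open>auto simp: defs not_less\<close>)
      qed
    qed (auto simp: defs)
    moreover have "sum ?w (A1 \<union> A2 \<union> A3 \<union> A4) = sum ?w A1 + sum ?w A2 + sum ?w A3 + sum ?w A4"
      using d d14 finG by (simp add: sum.union_disjoint Int_Un_distrib2)
    ultimately have "S (insert a K) T = sum ?w A1 + sum ?w A2 + sum ?w A3 + sum ?w A4"
      by (simp add: S_def)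
    then show ?thesis using s1 s2 s3 s4 False by (simp add: b_def)
  qed
qed

section \<open>Comparison with the powers of the operator\<close>

text \<open>A closing element needs a smaller free element in its block. The resulting sums, 1 for
  empty \<open>T\<close> and 0 otherwise, are the coordinates of the vacuum.\<close>

lemma NC_closing_empty_left:
  assumes "finite T" shows "NC_closing {} T = (if T = {} then {{}} else {})"
proof (cases "T = {}")
  case True
  then show ?thesis by (auto simp: NC_closing_def noncrossing_def partition_on_empty)
next
  case False
  then obtain b where b: "b \<in> T" by auto
  have False if \<pi>: "\<pi> \<in> NC_closing {} T" for \<pi>
  proof -
    obtain B where "B \<in> \<pi>" "b \<in> B" using closing_Union[OF _ assms \<pi>] b by auto
    then show False using closing_smaller[OF _ assms \<pi>] b by (metis empty_iff finite.emptyI)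
  qed
  then show ?thesis using False by auto
qed

text \<open>The prefactor redistributes weights. The recursion charges
  \<open>lam * s ^ (m - 1)\<close> for opening a block and nothing for moving an element into
  \<open>T\<close>, whereas the operator puts \<open>sqrt lam\<close> on both
  \<open>creation\<close> and \<open>annihilation\<close> and the power of \<open>s\<close> on
  \<open>annihilation\<close>; \<open>fock_weight_Suc\<close> makes the two agree. The set
  \<open>T\<close> stays arbitrary because the recursion changes its size.\<close>

lemma sum_NC_closing:
  assumes "lam > 0" "finite K" "finite T" "\<And>x y. x \<in> K \<Longrightarrow> y \<in> T \<Longrightarrow> x < y"
  shows "of_real (\<Sum>\<pi>\<in>NC_closing K T. NC_weight lam s t \<pi>)
    = of_real (sqrt lam ^ card T * fock_weight s (card T))
      * (poisson_op s t lam ^^ card K) vacuum (card T)"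
  using assms(2-4)
proof (induction K arbitrary: T rule: finite_linorder_max_induct)
  case empty
  then show ?case
    by (auto simp: NC_closing_empty_left NC_weight_def vacuum_def xi_def fock_weight_def)
next
  case (insert a K)
  have K: "\<And>y. y \<in> K \<Longrightarrow> y < a" and T: "\<And>y. y \<in> T \<Longrightarrow> a < y" using insert by auto
  have a: "a \<notin> K" "a \<notin> T" using K T by blast+
  define S where "S K T = (\<Sum>\<pi>\<in>NC_closing K T. NC_weight lam s t \<pi>)" for K T
  define x where "x = (poisson_op s t lam ^^ card K) vacuum"
  define q where "q = complex_of_real (sqrt lam)"
  define w where "w n = complex_of_real (fock_weight s n)" for n
  have wS: "w (Suc n) = of_real s ^ n * w n" for n by (simp add: w_def fock_weight_Suc)
  have lam: "complex_of_real lam = q * q"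
    using \<open>lam > 0\<close> by (simp add: q_def flip: of_real_mult)
  \<comment> \<open>The bound is weak so that \<open>T'\<close> may contain \<open>a\<close>, as in
    \<open>insert a T\<close>.\<close>
  have IH: "of_real (S K T') = q ^ card T' * w (card T') * x (card T')"
    if "finite T'" "\<And>y. y \<in> T' \<Longrightarrow> a \<le> y" for T'
    unfolding S_def x_def q_def w_def using insert.IH[of T'] that K
    by (force simp: order_less_le_trans)
  have step: "(poisson_op s t lam ^^ card (insert a K)) vacuum = poisson_op s t lam x"
    using a insert.hyps(1) by (simp add: x_def)
  have IH1: "of_real (S K (insert a T)) = q ^ Suc (card T) * w (Suc (card T)) * x (Suc (card T))"
  proof -
    have "a \<le> y" if "y \<in> insert a T" for y using that T[of y] by auto
    then show ?thesis using IH[of "insert a T"] a \<open>finite T\<close> by simp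
  qed
  have IH2: "of_real (S K T) = q ^ card T * w (card T) * x (card T)"
    using IH[of T] T \<open>finite T\<close> by (auto simp: less_imp_le)
  have rec: "S (insert a K) T = S K (insert a T) + lam * s ^ card T * S K T
    + (if T = {} then 0
       else lam * s ^ (card T - 1) * S K (T - {Min T}) + t ^ (card T - 1) * S K T)"
    unfolding S_def by (rule sum_NC_closing_step[OF insert.hyps(1) \<open>finite T\<close> K T])
  have "of_real (S (insert a K) T) = q ^ card T * w (card T) * poisson_op s t lam x (card T)"
  \<comment> \<open>At coordinate 0 both \<open>creation\<close> and \<open>intermediate\<close>
    vanish, in line with the missing terms of \<open>rec\<close>.\<close>
  proof (cases "T = {}")
    case True
    show ?thesis
      unfolding rec using True IH1 IH2
      by (simp add: poisson_op_def intermediate_def creation_def annihilation_def scalar_op_def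
          lam wS flip: q_def) (simp add: algebra_simps)
  next
    case False
    then obtain m where m: "card T = Suc m" using \<open>finite T\<close> by (cases "card T") auto
    have "card (T - {Min T}) = m" using False m \<open>finite T\<close> by simp
    then have IH3: "of_real (S K (T - {Min T})) = q ^ m * w m * x m"
      using IH[of "T - {Min T}"] T \<open>finite T\<close> by (auto simp: less_imp_le)
    show ?thesis
      unfolding rec using IH1 IH2 IH3 False m
      by (simp add: poisson_op_def intermediate_def creation_def annihilation_def scalar_op_def
          lam wS flip: q_def) (simp add: algebra_simps)
  qed
  then show ?case unfolding step by (simp add: S_def q_def w_def)
qed

section \<open>The moment formula\<close>

lemma NC_eq_NC_closing: "NC n = NC_closing {1..n} {}"
  by (auto simp: NC_def NC_closing_def)

text \<open>By \<open>dp_block\<close> the depth at an intermediate element equals the depth at the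
  maximum, and blocks with fewer than three elements add 0 to the exponent of
  \<open>t\<close>.\<close>

lemma NC_weight_eq:
  assumes \<pi>: "\<pi> \<in> NC n"
  shows "NC_weight lam s t \<pi> = lam ^ card \<pi> * s ^ td1 \<pi> * t ^ td2 \<pi>"
proof -
  have \<pi>': "\<pi> \<in> NC_closing {1..n} {}" using \<pi> by (simp add: NC_eq_NC_closing)
  have fin: "finite {1..n}" "finite {}" by simp_all
  have "td2 \<pi> = (\<Sum>B\<in>{B \<in> \<pi>. card B \<ge> 3}. (card B - 2) * dp \<pi> (Max B))"
    unfolding td2_def
  proof (rule sum.cong[OF refl])
    fix B assume "B \<in> {B \<in> \<pi>. card B \<ge> 3}"
    then have B: "B \<in> \<pi>" "card B \<ge> 3" by auto
    \<comment> \<open>Three elements cannot all be extremal, so the choice in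
      \<open>intermediate_elem\<close> has a witness and lands in \<open>B\<close>.\<close>
    have "card {Min B, Max B} \<le> 2" by (simp add: card_insert_if)
    then have "\<not> B \<subseteq> {Min B, Max B}" using card_mono[of "{Min B, Max B}" B] B by auto
    then have "\<exists>i. i \<in> B \<and> i \<noteq> Min B \<and> i \<noteq> Max B" by auto
    then have "intermediate_elem B \<in> B" unfolding intermediate_elem_def by (rule someI2_ex) auto
    then show "(card B - 2) * dp \<pi> (intermediate_elem B) = (card B - 2) * dp \<pi> (Max B)"
      using dp_block[OF \<pi> B(1) _ closing_Max[OF fin \<pi>' B(1)]] by simp
  qed
  also have "\<dots> = (\<Sum>B\<in>\<pi>. (card B - 2) * dp \<pi> (Max B))"
    using closing_finite[OF fin \<pi>'] by (intro sum.mono_neutral_left) auto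
  finally show ?thesis
    by (simp add: NC_weight_def block_weight_def prod.distrib td1_def power_sum)
qed

theorem theorem5p8:
  fixes lam s t :: real and n :: nat
  assumes "lam > 0" and "0 < s" and "s \<le> 1" and "0 < t" and "t \<le> 1" and "n \<ge> 1"
  shows "vacuum_expectation s (poisson_op s t lam ^^ n)
           = of_real (\<Sum>\<pi>\<in>NC n. lam ^ card \<pi> * s ^ td1 \<pi> * t ^ td2 \<pi>)
       \<and> (\<forall>\<mu>. is_vacuum_distribution s (poisson_op s t lam) \<mu> \<longrightarrow>
             (\<integral>x. x ^ n \<partial>\<mu>) = (\<Sum>\<pi>\<in>NC n. lam ^ card \<pi> * s ^ td1 \<pi> * t ^ td2 \<pi>))"
proof -
  \<comment> \<open>The vacuum has weight 1, so the expectation is coordinate 0, which corresponds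
    to having no closing elements.\<close>
  have "fock_inner s x vacuum = x 0" for x
  proof -
    have "fock_inner s x vacuum = (\<Sum>k\<in>{0}. of_real (fock_weight s k) * (x k * cnj (vacuum k)))"
      unfolding fock_inner_def by (rule suminf_finite) (auto simp: vacuum_def xi_def)
    then show ?thesis by (simp add: vacuum_def xi_def fock_weight_def)
  qed
  then have moment: "vacuum_expectation s (poisson_op s t lam ^^ n)
      = of_real (\<Sum>\<pi>\<in>NC n. lam ^ card \<pi> * s ^ td1 \<pi> * t ^ td2 \<pi>)"
    using sum_NC_closing[OF assms(1), of "{1..n}" "{}" s t]
    unfolding NC_eq_NC_closing[symmetric]
    by (simp add: vacuum_expectation_def fock_weight_def NC_weight_eq)
  then show ?thesis
    unfolding is_vacuum_distribution_def by (metis of_real_eq_iff)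
qed

end
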